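(* A vector lattice $X$ is universally complete if and only if it is uo-complete.
   Context: A vector lattice is order complete if every nonempty subset that is bounded above has a supremum; it is laterally complete if every set of pairwise disjoint positive elements has a supremum; it is universally complete if it is both order complete and laterally complete. A net $(x_\alpha)_{\alpha\in A}$ in $X$ is order convergent to $x$ (written $x_\alpha\overset{o}{\longrightarrow}x$) if there is a net $(y_\beta)_{\beta\in B}$ in $X$ with $y_\beta\downarrow 0$ such that for each $\beta\in B$ there is $\alpha_\beta\in A$ with $|x_\alpha-x|\le y_\beta$ for all $\alpha\ge\alpha_\beta$. A net $(x_\alpha)$ converges in unbounded order to $x$ (is uo-convergent to $x$, written $x_\alpha\overset{uo}{\longrightarrow}x$) if $|x_\alpha-x|\wedge y\overset{o}{\longrightarrow}0$ for every $y\in X_+$, where $X_+$ is the positive cone of $X$. A net $(x_\alpha)_{\alpha\in A}$ is uo-Cauchy if the double net $(x_\alpha-x_\beta)_{(\alpha,\beta)\in A\times A}$ is uo-convergent to $0$. $X$ is uo-complete if every uo-Cauchy net in $X$ is uo-convergent to some element of $X$.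
   Formalization: The vector lattice X is assumed Archimedean: the lexicographic plane is uo-complete but not order complete, so the claim fails without this. In "laterally complete", the sets of pairwise disjoint positive elements are taken nonempty. *)

theory Defs
  imports Complex_Main "HOL-Library.Lattice_Algebras" "HOL-Library.Lub_Glb"
begin

class vector_lattice = ordered_real_vector + lattice_ab_group_add_abs

definition archimedean :: "'a::vector_lattice itself \<Rightarrow> bool" where
  "archimedean _ \<longleftrightarrow>
    (\<forall>x y :: 'a. 0 \<le> x \<longrightarrow> (\<forall>n::nat. real n *\<^sub>R x \<le> y) \<longrightarrow> x = 0)"

definition order_complete :: "'a::vector_lattice itself \<Rightarrow> bool" where
  "order_complete _ \<longleftrightarrow>
    (\<forall>S :: 'a set. S \<noteq> {} \<longrightarrow> bdd_above S \<longrightarrow> (\<exists>s. isLub UNIV S s))"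

(* The empty family is excluded: its supremum in the whole space would be a least element,
   which exists only in the zero space. *)
definition laterally_complete :: "'a::vector_lattice itself \<Rightarrow> bool" where
  "laterally_complete _ \<longleftrightarrow>
    (\<forall>S :: 'a set. S \<noteq> {} \<longrightarrow> (\<forall>x\<in>S. 0 \<le> x) \<longrightarrow> pairwise (\<lambda>x y. inf x y = 0) S \<longrightarrow>
      (\<exists>s. isLub UNIV S s))"

definition universally_complete :: "'a::vector_lattice itself \<Rightarrow> bool" where
  "universally_complete X \<longleftrightarrow> order_complete X \<and> laterally_complete X"

(* A net is a function restricted to a directed set A; (a, b) \<in> r means a \<le> b. *)
definition directed_set :: "'i set \<Rightarrow> 'i rel \<Rightarrow> bool" where
  "directed_set A r \<longleftrightarrow> A \<noteq> {} \<and> preorder_on A r \<and>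
    (\<forall>a\<in>A. \<forall>b\<in>A. \<exists>c\<in>A. (a, c) \<in> r \<and> (b, c) \<in> r)"

definition decreases_to_zero :: "'b set \<Rightarrow> 'b rel \<Rightarrow> ('b \<Rightarrow> 'a::vector_lattice) \<Rightarrow> bool" where
  "decreases_to_zero B s y \<longleftrightarrow>
    (\<forall>(b, c)\<in>s. y c \<le> y b) \<and> isGlb UNIV (y ` B) 0"

(* A formula cannot quantify over types, so the dominating net is indexed by a directed set
   inside the space itself. This loses no generality: see order_convergesI. *)
definition order_converges :: "'i set \<Rightarrow> 'i rel \<Rightarrow> ('i \<Rightarrow> 'a::vector_lattice) \<Rightarrow> 'a \<Rightarrow> bool" where
  "order_converges A r x l \<longleftrightarrow>
    (\<exists>(B :: 'a set) s y. directed_set B s \<and> decreases_to_zero B s y \<and>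
      (\<forall>b\<in>B. \<exists>a0\<in>A. \<forall>a\<in>A. (a0, a) \<in> r \<longrightarrow> \<bar>x a - l\<bar> \<le> y b))"

definition uo_converges :: "'i set \<Rightarrow> 'i rel \<Rightarrow> ('i \<Rightarrow> 'a::vector_lattice) \<Rightarrow> 'a \<Rightarrow> bool" where
  "uo_converges A r x l \<longleftrightarrow>
    (\<forall>y\<ge>0. order_converges A r (\<lambda>a. inf \<bar>x a - l\<bar> y) 0)"

definition product_rel :: "'i rel \<Rightarrow> ('i \<times> 'i) rel" where
  "product_rel r = {((a, b), (c, d)). (a, c) \<in> r \<and> (b, d) \<in> r}"

definition uo_Cauchy :: "'i set \<Rightarrow> 'i rel \<Rightarrow> ('i \<Rightarrow> 'a::vector_lattice) \<Rightarrow> bool" where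
  "uo_Cauchy A r x \<longleftrightarrow> uo_converges (A \<times> A) (product_rel r) (\<lambda>(a, b). x a - x b) 0"

(* Index sets are taken inside the fixed type 'a set \<times> 'a, which is large enough to carry a
   copy of every tail filter on the space; uo_completeD gives the property for nets with index
   sets in an arbitrary type. *)
definition uo_complete :: "'a::vector_lattice itself \<Rightarrow> bool" where
  "uo_complete _ \<longleftrightarrow>
    (\<forall>(A :: ('a set \<times> 'a) set) r (x :: 'a set \<times> 'a \<Rightarrow> 'a).
      directed_set A r \<longrightarrow> uo_Cauchy A r x \<longrightarrow> (\<exists>l. uo_converges A r x l))"

lemma directed_set_product:
  assumes "directed_set A r"
  shows "directed_set (A \<times> A) (product_rel r)"
proof -
  have ub: "\<exists>c\<in>A. (a, c) \<in> r \<and> (b, c) \<in> r" if "a \<in> A" "b \<in> A" for a b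
    using assms that unfolding directed_set_def by blast
  have "\<exists>w\<in>A \<times> A. (p, w) \<in> product_rel r \<and> (q, w) \<in> product_rel r"
    if pq: "p \<in> A \<times> A" "q \<in> A \<times> A" for p q
  proof -
    obtain a b c d where "p = (a, b)" "q = (c, d)" "a \<in> A" "b \<in> A" "c \<in> A" "d \<in> A"
      using pq by blast
    moreover from this obtain e f where
      "e \<in> A" "(a, e) \<in> r" "(c, e) \<in> r" "f \<in> A" "(b, f) \<in> r" "(d, f) \<in> r"
      using ub by metis
    ultimately show ?thesis
      by (intro bexI[of _ "(e, f)"]) (simp_all add: product_rel_def)
  qed
  moreover have "preorder_on (A \<times> A) (product_rel r)"
  proof -
    have r: "r \<subseteq> A \<times> A" "\<forall>x\<in>A. (x, x) \<in> r" "trans r"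
      using assms unfolding directed_set_def preorder_on_def refl_on_def by blast+
    have "trans (product_rel r)"
      using r(3) by (auto intro!: transI simp: product_rel_def dest: transD)
    then show ?thesis
      using r(1,2) unfolding preorder_on_def refl_on_def product_rel_def by auto
  qed
  ultimately show ?thesis using assms unfolding directed_set_def by blast
qed

lemma order_convergesI:
  fixes x :: "'i \<Rightarrow> 'a::vector_lattice" and y :: "'b \<Rightarrow> 'a"
  assumes B: "directed_set B s" and y: "decreases_to_zero B s y"
    and dom: "\<forall>b\<in>B. \<exists>a0\<in>A. \<forall>a\<in>A. (a0, a) \<in> r \<longrightarrow> \<bar>x a - l\<bar> \<le> y b"
  shows "order_converges A r x l"
  unfolding order_converges_def
proof (intro exI conjI)
  let ?B = "y ` B" and ?s = "{(u, v). u \<in> y ` B \<and> v \<in> y ` B \<and> v \<le> u}"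
  have mono: "y c \<le> y b" if "(b, c) \<in> s" for b c
    using y that unfolding decreases_to_zero_def by blast
  have "\<exists>w\<in>?B. (u, w) \<in> ?s \<and> (v, w) \<in> ?s" if uv: "u \<in> ?B" "v \<in> ?B" for u v
  proof -
    obtain b c where bc: "b \<in> B" "u = y b" "c \<in> B" "v = y c" using uv by blast
    then obtain d where "d \<in> B" "(b, d) \<in> s" "(c, d) \<in> s"
      using B unfolding directed_set_def by blast
    then show ?thesis using mono bc by blast
  qed
  moreover have "preorder_on ?B ?s"
    unfolding preorder_on_def refl_on_def trans_def by auto
  ultimately show "directed_set ?B ?s"
    using B unfolding directed_set_def by blast
  show "decreases_to_zero ?B ?s (\<lambda>u. u)"
    using y unfolding decreases_to_zero_def by auto
  show "\<forall>b\<in>?B. \<exists>a0\<in>A. \<forall>a\<in>A. (a0, a) \<in> r \<longrightarrow> \<bar>x a - l\<bar> \<le> b"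
    using dom by blast
qed

lemma order_converges_reindex:
  fixes x :: "'i \<Rightarrow> 'a::vector_lattice" and z :: "'j \<Rightarrow> 'a"
  assumes "order_converges A r x l"
    and "\<And>a0. a0 \<in> A \<Longrightarrow> \<exists>b0\<in>B. \<forall>b\<in>B. (b0, b) \<in> s \<longrightarrow> (\<exists>a\<in>A. (a0, a) \<in> r \<and> z b = x a)"
  shows "order_converges B s z l"
proof -
  obtain D :: "'a set" and t y where D: "directed_set D t" "decreases_to_zero D t y"
    and dom: "\<forall>d\<in>D. \<exists>a0\<in>A. \<forall>a\<in>A. (a0, a) \<in> r \<longrightarrow> \<bar>x a - l\<bar> \<le> y d"
    using assms(1) unfolding order_converges_def by blast
  have "\<exists>b0\<in>B. \<forall>b\<in>B. (b0, b) \<in> s \<longrightarrow> \<bar>z b - l\<bar> \<le> y d" if d: "d \<in> D" for d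
  proof -
    obtain a0 where a0: "a0 \<in> A" "\<forall>a\<in>A. (a0, a) \<in> r \<longrightarrow> \<bar>x a - l\<bar> \<le> y d"
      using dom d by blast
    obtain b0 where b0: "b0 \<in> B"
      "\<forall>b\<in>B. (b0, b) \<in> s \<longrightarrow> (\<exists>a\<in>A. (a0, a) \<in> r \<and> z b = x a)"
      using assms(2)[OF a0(1)] by blast
    have "\<bar>z b - l\<bar> \<le> y d" if b: "b \<in> B" "(b0, b) \<in> s" for b
    proof -
      obtain a where "a \<in> A" "(a0, a) \<in> r" "z b = x a" using b0(2) b by blast
      then show ?thesis using a0(2) by simp
    qed
    then show ?thesis using b0(1) by blast
  qed
  then show ?thesis by (intro order_convergesI[OF D] ballI)
qed

lemma uo_completeD:
  fixes x :: "'i \<Rightarrow> 'a::vector_lattice"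
  assumes complete: "uo_complete TYPE('a)"
    and dir: "directed_set A r" and Cauchy: "uo_Cauchy A r x"
  shows "\<exists>l. uo_converges A r x l"
proof -
  define T where "T a = x ` {b \<in> A. (a, b) \<in> r}" for a
  define A' where "A' = {(S, u). S \<in> T ` A \<and> u \<in> S}"
  define r' where "r' = {(p, q). p \<in> A' \<and> q \<in> A' \<and> fst q \<subseteq> fst p}"
  have rfl: "(a, a) \<in> r" if "a \<in> A" for a
    using dir that unfolding directed_set_def preorder_on_def refl_on_def by blast
  have trn: "(a, c) \<in> r" if "(a, b) \<in> r" "(b, c) \<in> r" for a b c
    using dir that unfolding directed_set_def preorder_on_def trans_def by blast
  have T_mono: "T b \<subseteq> T a" if "(a, b) \<in> r" for a b
    using that trn unfolding T_def by blast
  have mem: "(T a, x a) \<in> A'" if "a \<in> A" for a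
    using that rfl unfolding A'_def T_def by blast
  have r'D: "\<exists>b\<in>A. (a, b) \<in> r \<and> snd q = x b" if "((T a, x a), q) \<in> r'" for a q
    using that unfolding r'_def A'_def T_def by fastforce
  have "\<exists>w\<in>A'. (p, w) \<in> r' \<and> (q, w) \<in> r'" if pq: "p \<in> A'" "q \<in> A'" for p q
  proof -
    obtain a b where ab: "a \<in> A" "fst p = T a" "b \<in> A" "fst q = T b"
      using pq unfolding A'_def by auto
    then obtain c where "c \<in> A" "(a, c) \<in> r" "(b, c) \<in> r"
      using dir unfolding directed_set_def by blast
    then show ?thesis
      using ab pq mem T_mono unfolding r'_def by (intro bexI[of _ "(T c, x c)"]) auto
  qed
  moreover have "A' \<noteq> {}" using mem dir unfolding directed_set_def by blast
  moreover have "preorder_on A' r'"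
    unfolding preorder_on_def refl_on_def trans_def r'_def by auto
  ultimately have dir': "directed_set A' r'" unfolding directed_set_def by blast
  have "uo_Cauchy A' r' snd"
    unfolding uo_Cauchy_def uo_converges_def
  proof (intro allI impI)
    fix y :: 'a assume "0 \<le> y"
    then have "order_converges (A \<times> A) (product_rel r)
        (\<lambda>a. inf \<bar>(case a of (a, b) \<Rightarrow> x a - x b) - 0\<bar> y) 0"
      using Cauchy unfolding uo_Cauchy_def uo_converges_def by blast
    then show "order_converges (A' \<times> A') (product_rel r')
        (\<lambda>a. inf \<bar>(case a of (a, b) \<Rightarrow> snd a - snd b) - 0\<bar> y) 0"
    proof (rule order_converges_reindex)
      fix c assume "c \<in> A \<times> A"
      then obtain a b where c: "c = (a, b)" "a \<in> A" "b \<in> A" by blast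
      show "\<exists>b0\<in>A' \<times> A'. \<forall>q\<in>A' \<times> A'. (b0, q) \<in> product_rel r' \<longrightarrow>
          (\<exists>a\<in>A \<times> A. (c, a) \<in> product_rel r \<and>
            (inf \<bar>(case q of (a, b) \<Rightarrow> snd a - snd b) - 0\<bar> y) =
            (inf \<bar>(case a of (a, b) \<Rightarrow> x a - x b) - 0\<bar> y))"
      proof (intro bexI[of _ "((T a, x a), (T b, x b))"] ballI impI)
        fix q assume "(((T a, x a), (T b, x b)), q) \<in> product_rel r'"
        then obtain p1 p2 where q: "q = (p1, p2)"
          and p: "((T a, x a), p1) \<in> r'" "((T b, x b), p2) \<in> r'"
          unfolding product_rel_def by blast
        obtain a' b' where "a' \<in> A" "(a, a') \<in> r" "snd p1 = x a'"
          "b' \<in> A" "(b, b') \<in> r" "snd p2 = x b'"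
          using r'D[OF p(1)] r'D[OF p(2)] by blast
        then show "\<exists>a\<in>A \<times> A. (c, a) \<in> product_rel r \<and>
            (inf \<bar>(case q of (a, b) \<Rightarrow> snd a - snd b) - 0\<bar> y) =
            (inf \<bar>(case a of (a, b) \<Rightarrow> x a - x b) - 0\<bar> y)"
          using q c by (intro bexI[of _ "(a', b')"]) (auto simp: product_rel_def)
      qed (use c mem in auto)
    qed
  qed
  then obtain l where l: "uo_converges A' r' snd l"
    using complete dir' unfolding uo_complete_def by blast
  have "uo_converges A r x l"
    unfolding uo_converges_def
  proof (intro allI impI)
    fix y :: 'a assume "0 \<le> y"
    then have "order_converges A' r' (\<lambda>a. inf \<bar>snd a - l\<bar> y) 0"
      using l unfolding uo_converges_def by blast
    then show "order_converges A r (\<lambda>a. inf \<bar>x a - l\<bar> y) 0"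
    proof (rule order_converges_reindex)
      fix p assume p: "p \<in> A'"
      then obtain a where a: "a \<in> A" "fst p = T a" unfolding A'_def by auto
      show "\<exists>b0\<in>A. \<forall>b\<in>A. (b0, b) \<in> r \<longrightarrow>
          (\<exists>q\<in>A'. (p, q) \<in> r' \<and> (inf \<bar>x b - l\<bar> y) = (inf \<bar>snd q - l\<bar> y))"
      proof (intro bexI[of _ a] ballI impI)
        fix b assume "b \<in> A" "(a, b) \<in> r"
        then show "\<exists>q\<in>A'. (p, q) \<in> r' \<and> (inf \<bar>x b - l\<bar> y) = (inf \<bar>snd q - l\<bar> y)"
          using a p mem T_mono unfolding r'_def by (intro bexI[of _ "(T b, x b)"]) auto
      qed (rule a)
    qed
  qed
  then show ?thesis ..
qed

(* Universal completeness implies the Archimedean property, uo-completeness does not: the lexicographically ordered plane is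
   uo-complete but not order complete. *)
lemma order_complete_imp_archimedean:
  assumes "order_complete TYPE('a::vector_lattice)"
  shows "archimedean TYPE('a)"
  unfolding archimedean_def
proof (intro allI impI)
  fix x y :: 'a
  assume x: "0 \<le> x" and y: "\<forall>n::nat. real n *\<^sub>R x \<le> y"
  let ?S = "range (\<lambda>n::nat. real n *\<^sub>R x)"
  have "bdd_above ?S" using y by auto
  then obtain s where s: "isLub UNIV ?S s"
    using assms unfolding order_complete_def by blast
  have "real n *\<^sub>R x \<le> s - x" for n
  proof -
    have "real (Suc n) *\<^sub>R x \<le> s" using isLubD2[OF s] by blast
    then show ?thesis by (simp add: algebra_simps)
  qed
  then have "isUb UNIV ?S (s - x)" by (auto intro!: isUbI setleI)
  then have "s \<le> s - x" using isLub_le_isUb[OF s] by blast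
  then have "x \<le> 0" by simp
  then show "x = 0" using x by (rule antisym)
qed

end

theory Submission
  imports Defs
begin

text \<open>
  An eventual bound of a net of positive elements is an element that dominates a tail of the net.
  A net is order convergent to \<open>0\<close> exactly when the infimum of the eventual bounds of its
  absolute values is \<open>0\<close> (\<open>order_converges_iff_isGlb\<close>). Replacing a net by its tail filter
  turns uo-convergence and the uo-Cauchy property into one notion, \<open>uo_null\<close>, for the differences
  \<open>x a - l\<close> along the filter and \<open>x a - x b\<close> along its square.

  From uo-completeness to suprema: a set is bounded above by the same elements as the increasing
  net of its finite suprema, and for disjoint positive elements finite suprema are finite sums. In
  both cases the net is uo-Cauchy. The reason is that in an Archimedean space the gaps between
  the upper bounds and the members of a nonempty set that is bounded above have infimum \<open>0\<close>
  (\<open>archimedean_gap_le_zero\<close>); for bounded sets this applies to the net itself, for disjoint sums to its truncations, because the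
  truncation of a sum of disjoint elements is the sum of the truncations. The uo-limit of an
  increasing net is its supremum.

  From universal completeness to uo-limits: positive and negative parts reduce the claim to a
  uo-Cauchy net of positive elements. Its limit has to be the limit inferior, the supremum of the
  elements that lie below a tail, and once this supremum exists the convergence follows from the
  Cauchy property (\<open>uo_limit_of_nonneg\<close>). The difficulty is to bound these elements from above. The
  Cauchy property bounds them on some nonzero part of each nonzero positive element \<open>e\<close>: if \<open>d\<close> is an
  eventual bound of the differences truncated at \<open>e\<close> that does not dominate \<open>e\<close>, then on the part
  where \<open>d\<close> is smaller than \<open>e\<close> the tail of the net stays within \<open>e\<close> of one of its members. By
  Zorn's lemma, such parts exhaust the space with disjoint pieces, and lateral completeness glues
  the bounds on the pieces to a global bound (\<open>bdd_above_of_locally_bounded\<close>).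
\<close>

section \<open>Disjointness in a vector lattice\<close>

lemma inf_add_le:
  fixes a b c :: "'a::lattice_ab_group_add"
  assumes "0 \<le> a" "0 \<le> b" "0 \<le> c"
  shows "inf (a + b) c \<le> inf a c + inf b c"
proof -
  have "inf a c + inf b c = inf (inf (a + b) (a + c)) (inf (c + b) (c + c))"
    by (simp add: add_sup_inf_distribs inf_aci add.commute)
  moreover have "inf (a + b) c \<le> inf (inf (a + b) (a + c)) (inf (c + b) (c + c))"
    using assms by (simp add: le_infI2 add_increasing add_increasing2)
  ultimately show ?thesis by simp
qed

lemma disjoint_mono:
  fixes a b :: "'a::lattice_ab_group_add"
  assumes "inf a b = 0" "0 \<le> a'" "a' \<le> a" "0 \<le> b'" "b' \<le> b"
  shows "inf a' b' = 0"
  using inf_mono[OF assms(3,5)] assms by (intro antisym) auto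

lemma disjoint_add:
  fixes a b c :: "'a::lattice_ab_group_add"
  assumes "inf a c = 0" "inf b c = 0"
  shows "inf (a + b) c = 0"
proof (rule antisym)
  have nonneg: "0 \<le> a" "0 \<le> b" "0 \<le> c"
    using assms by (metis inf_le1 inf_le2)+
  then show "inf (a + b) c \<le> 0" using inf_add_le[of a b c] assms by simp
  show "0 \<le> inf (a + b) c" using nonneg by simp
qed

lemma disjoint_scaleR:
  fixes a c :: "'a::vector_lattice"
  assumes "inf a c = 0"
  shows "inf (real n *\<^sub>R a) c = 0"
proof (induction n)
  case 0
  have "0 \<le> c" using assms by (metis inf_le2)
  then show ?case by (simp add: inf_absorb1)
next
  case (Suc n)
  then show ?case using disjoint_add[OF assms Suc] by (simp add: scaleR_left_distrib)
qed

lemma disjoint_sum: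
  fixes c :: "'a::lattice_ab_group_add"
  assumes "0 \<le> c" "\<And>v. v \<in> F \<Longrightarrow> inf v c = 0"
  shows "inf (\<Sum>F) c = 0"
  using assms(2)
  by (induction F rule: infinite_finite_induct) (auto simp: inf_absorb1 assms(1) disjoint_add)

lemma disjoint_pprt_uminus:
  fixes t :: "'a::lattice_ab_group_add"
  shows "inf (pprt t) (pprt (- t)) = 0"
proof -
  have "inf (pprt t) (pprt (- t)) = inf (t - nprt t) (0 - nprt t)"
    using prts[of t] by (metis add_diff_cancel_right' diff_0 pprt_neg)
  also have "\<dots> = inf t 0 - nprt t"
    by (simp only: diff_conv_add_uminus add_inf_distrib_right)
  finally show ?thesis by (simp add: nprt_def)
qed

text \<open>
  Let \<open>t = inf s c\<close>. Every member \<open>y\<close> of \<open>S\<close> is disjoint from \<open>t\<close>, so that \<open>y + t\<close> is the supremum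
  of \<open>y\<close> and \<open>t\<close> and stays below \<open>s\<close>. Hence \<open>s - t\<close> is an upper bound of \<open>S\<close>, which forces
  \<open>t \<le> 0\<close>.
\<close>

lemma disjoint_isLub:
  fixes c :: "'a::lattice_ab_group_add"
  assumes s: "isLub UNIV S s" and "S \<noteq> {}" and disj: "\<And>x. x \<in> S \<Longrightarrow> inf x c = 0"
  shows "inf s c = 0"
proof (rule antisym)
  obtain x where x: "x \<in> S" using \<open>S \<noteq> {}\<close> by blast
  then have "0 \<le> x" "0 \<le> c" using disj by (metis inf_le1 inf_le2)+
  then show nonneg: "0 \<le> inf s c" using isLubD2[OF s x] by simp
  have "y \<le> s - inf s c" if y: "y \<in> S" for y
  proof -
    have "0 \<le> y" using disj[OF y] by (metis inf_le1)
    then have "inf y (inf s c) = 0"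
      using disjoint_mono[OF disj[OF y], of y "inf s c"] nonneg by simp
    \<comment> \<open>Disjoint elements have their supremum as their sum.\<close>
    then have "y + inf s c = sup y (inf s c)" using add_eq_inf_sup[of y "inf s c"] by simp
    also have "\<dots> \<le> s" using isLubD2[OF s y] by simp
    finally show ?thesis by (simp only: le_diff_eq)
  qed
  then have "s \<le> s - inf s c" by (intro isLub_le_isUb[OF s] isUb_UNIV_I)
  then show "inf s c \<le> 0" by (simp only: le_diff_eq add_le_same_cancel1)
qed

lemma abs_eq_pprt_add_pprt:
  fixes t :: "'a::lattice_ab_group_add_abs"
  shows "\<bar>t\<bar> = pprt t + pprt (- t)"
  by (simp add: abs_prts pprt_neg)

lemma eq_pprt_diff_pprt:
  fixes t :: "'a::lattice_ab_group_add"
  shows "t = pprt t - pprt (- t)"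
  using prts[of t] by (simp add: pprt_neg)

lemma abs_pprt_diff_le:
  fixes a b :: "'a::lattice_ab_group_add_abs"
  shows "\<bar>pprt a - pprt b\<bar> \<le> \<bar>a - b\<bar>"
proof -
  have "pprt a - pprt b \<le> \<bar>a - b\<bar>" for a b :: 'a
  proof -
    have "a = b + (a - b)" by simp
    also have "\<dots> \<le> pprt b + \<bar>a - b\<bar>"
      by (intro add_mono abs_ge_self) (simp add: pprt_def)
    finally have "pprt a \<le> pprt b + \<bar>a - b\<bar>" by (simp add: pprt_def[of a])
    then show ?thesis by (simp add: algebra_simps)
  qed
  from this[of a b] this[of b a] show ?thesis
    by (intro abs_leI) (auto simp: abs_minus_commute)
qed

lemma abs_inf_diff_le:
  fixes a b y :: "'a::lattice_ab_group_add_abs"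
  assumes "0 \<le> a" "0 \<le> b" "0 \<le> y"
  shows "\<bar>inf a y - inf b y\<bar> \<le> inf \<bar>a - b\<bar> y"
proof -
  have "inf a y - inf b y \<le> inf \<bar>a - b\<bar> y" if "0 \<le> a" "0 \<le> b" for a b :: 'a
  proof (rule le_infI)
    have "a = b + (a - b)" by simp
    also have "\<dots> \<le> b + \<bar>a - b\<bar>" by (intro add_mono abs_ge_self) simp
    finally have "inf a y \<le> inf (b + \<bar>a - b\<bar>) (y + \<bar>a - b\<bar>)"
      by (intro inf_mono) (auto simp: add_increasing2)
    then have "inf a y \<le> inf b y + \<bar>a - b\<bar>" by (simp add: add_inf_distrib_right)
    then show "inf a y - inf b y \<le> \<bar>a - b\<bar>" by (simp only: diff_le_eq add.commute)
    have "inf a y \<le> y + inf b y" using that assms by (simp add: add_increasing2 le_infI2)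
    then show "inf a y - inf b y \<le> y" by (simp only: diff_le_eq)
  qed
  from this[of a b] this[of b a] show ?thesis
    using assms by (intro abs_leI) (simp_all only: abs_minus_commute minus_diff_eq)
qed

text \<open>
  Truncation from above at \<open>y\<close> changes only the positive part of \<open>t\<close>. In the limit argument the
  right-hand side arises as the distance of \<open>inf x (y + l)\<close> from \<open>l\<close>, where \<open>t = x - l\<close>.
\<close>

lemma inf_abs_le_abs_inf:
  fixes t y :: "'a::lattice_ab_group_add_abs"
  assumes "0 \<le> y"
  shows "inf \<bar>t\<bar> y \<le> \<bar>inf t y\<bar>"
proof -
  let ?m = "pprt (- t)"
  have m: "pprt (- inf t y) = ?m"
    using assms by (simp add: pprt_def sup_assoc sup_absorb2)
  have "inf (pprt t) y - ?m = inf (pprt t - ?m) (y - ?m)"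
    by (simp only: diff_conv_add_uminus add_inf_distrib_right)
  also have "\<dots> \<le> inf t y"
    using eq_pprt_diff_pprt[of t] by (intro inf_mono) (auto simp: diff_le_eq add_increasing2)
  finally have 1: "inf (pprt t) y \<le> inf t y + ?m" by (simp only: diff_le_eq)
  have "inf \<bar>t\<bar> y \<le> inf (pprt t) y + inf ?m y"
    unfolding abs_eq_pprt_add_pprt using assms by (intro inf_add_le) auto
  also have "\<dots> \<le> (inf t y + ?m) + ?m" by (intro add_mono 1) simp
  also have "\<dots> = pprt (inf t y) + ?m"
    using eq_pprt_diff_pprt[of "inf t y"] unfolding m by (metis diff_add_cancel)
  also have "\<dots> = \<bar>inf t y\<bar>" unfolding abs_eq_pprt_add_pprt m ..
  finally show ?thesis .
qed

section \<open>Unbounded order convergence along a filter\<close>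

text \<open>
  The filter generated by the tails. Double nets become products of filters, and choosing indices
  beyond finitely many others is left to the calculus of \<open>eventually\<close>.
\<close>

definition net_filter :: "'i set \<Rightarrow> 'i rel \<Rightarrow> 'i filter" where
  "net_filter A r = (INF a\<in>A. principal {b \<in> A. (a, b) \<in> r})"

lemma eventually_net_filter:
  assumes "directed_set A r"
  shows "eventually P (net_filter A r) \<longleftrightarrow> (\<exists>a\<in>A. \<forall>b\<in>A. (a, b) \<in> r \<longrightarrow> P b)"
proof -
  have trn: "(a, c) \<in> r" if "(a, b) \<in> r" "(b, c) \<in> r" for a b c
    using assms that unfolding directed_set_def preorder_on_def trans_def by blast
  have "\<exists>c\<in>A. principal {d \<in> A. (c, d) \<in> r}
      \<le> inf (principal {d \<in> A. (a, d) \<in> r}) (principal {d \<in> A. (b, d) \<in> r})"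
    if ab: "a \<in> A" "b \<in> A" for a b
  proof -
    obtain c where "c \<in> A" "(a, c) \<in> r" "(b, c) \<in> r"
      using assms ab unfolding directed_set_def by blast
    then show ?thesis using trn by (intro bexI[of _ c]) auto
  qed
  moreover have "A \<noteq> {}" using assms unfolding directed_set_def by blast
  ultimately show ?thesis
    unfolding net_filter_def by (subst eventually_INF_base) (auto simp: eventually_principal)
qed

lemma net_filter_neq_bot:
  assumes "directed_set A r"
  shows "net_filter A r \<noteq> bot"
proof -
  have "\<forall>a\<in>A. (a, a) \<in> r"
    using assms unfolding directed_set_def preorder_on_def refl_on_def by blast
  then have "\<not> eventually (\<lambda>_. False) (net_filter A r)"
    unfolding eventually_net_filter[OF assms] by blast
  then show ?thesis by (auto simp: trivial_limit_def)
qed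

lemma net_filter_product:
  assumes "directed_set A r"
  shows "net_filter (A \<times> A) (product_rel r) = net_filter A r \<times>\<^sub>F net_filter A r"
proof (rule filter_eqI)
  fix P
  have trn: "(a, c) \<in> r" if "(a, b) \<in> r" "(b, c) \<in> r" for a b c
    using assms that unfolding directed_set_def preorder_on_def trans_def by blast
  show "eventually P (net_filter (A \<times> A) (product_rel r))
      \<longleftrightarrow> eventually P (net_filter A r \<times>\<^sub>F net_filter A r)" (is "?L \<longleftrightarrow> ?R")
  proof
    assume ?L
    then obtain a b where ab: "a \<in> A" "b \<in> A"
      and P: "\<And>c d. \<lbrakk>c \<in> A; d \<in> A; (a, c) \<in> r; (b, d) \<in> r\<rbrakk> \<Longrightarrow> P (c, d)"
      unfolding eventually_net_filter[OF directed_set_product[OF assms]]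
      by (fastforce simp: product_rel_def)
    obtain e where "e \<in> A" "(a, e) \<in> r" "(b, e) \<in> r"
      using assms ab unfolding directed_set_def by blast
    then show ?R
      unfolding eventually_prod_same eventually_net_filter[OF assms]
      using trn P by (intro exI[of _ "\<lambda>c. c \<in> A \<and> (e, c) \<in> r"]) blast
  next
    assume ?R
    then obtain Q a where "a \<in> A" "\<forall>b\<in>A. (a, b) \<in> r \<longrightarrow> Q b" "\<forall>x y. Q x \<longrightarrow> Q y \<longrightarrow> P (x, y)"
      unfolding eventually_prod_same eventually_net_filter[OF assms] by blast
    then show ?L
      unfolding eventually_net_filter[OF directed_set_product[OF assms]]
      by (intro bexI[of _ "(a, a)"]) (auto simp: product_rel_def)
  qed
qed

text \<open>
  The eventual bounds are nonnegative and closed under binary infima, so they form a dominating net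
  themselves, and the values of any other dominating net are among them.
\<close>

lemma order_converges_iff_isGlb:
  assumes dir: "directed_set A r"
  shows "order_converges A r x l \<longleftrightarrow>
    isGlb UNIV {d. \<forall>\<^sub>F a in net_filter A r. \<bar>x a - l\<bar> \<le> d} 0"
proof
  let ?F = "net_filter A r" and ?D = "{d. \<forall>\<^sub>F a in net_filter A r. \<bar>x a - l\<bar> \<le> d}"
  have nonneg: "0 \<le> d" if "d \<in> ?D" for d
  proof -
    have "\<exists>a. \<bar>x a - l\<bar> \<le> d"
      using that net_filter_neq_bot[OF dir] eventually_happens' by blast
    then show ?thesis by (meson abs_ge_zero order_trans)
  qed
  {
    assume "order_converges A r x l"
    then obtain B :: "'b set" and s y where y: "decreases_to_zero B s y"
      and dom: "\<forall>b\<in>B. \<exists>a0\<in>A. \<forall>a\<in>A. (a0, a) \<in> r \<longrightarrow> \<bar>x a - l\<bar> \<le> y b"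
      unfolding order_converges_def by blast
    have sub: "y ` B \<subseteq> ?D" using dom by (auto simp: eventually_net_filter[OF dir])
    have glb: "isGlb UNIV (y ` B) 0" using y unfolding decreases_to_zero_def by blast
    show "isGlb UNIV ?D 0"
    proof (intro isGlbI2 isLbI setgeI setleI)
      show "\<forall>c\<in>Collect (isLb UNIV ?D). c \<le> 0"
      proof
        fix c assume "c \<in> Collect (isLb UNIV ?D)"
        then have "c \<le> d" if "d \<in> ?D" for d
          using that by (simp add: isLbD)
        then have "isLb UNIV (y ` B) c" using sub by (intro isLbI setgeI) auto
        then show "c \<le> 0" using isGlb_le_isLb[OF glb] by blast
      qed
    qed (use nonneg in auto)
  }
  {
    assume glb: "isGlb UNIV ?D 0"
    let ?s = "{(u, v). u \<in> ?D \<and> v \<in> ?D \<and> v \<le> u}"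
    \<comment> \<open>With no eventual bound every element would be a lower bound, making the space trivial.\<close>
    have "?D \<noteq> {}"
    proof
      assume "?D = {}"
      then have "isLb UNIV ?D c" for c by (simp add: isLb_def setge_def)
      then have le: "c \<le> 0" for c :: 'b using isGlb_le_isLb[OF glb] by blast
      then have "\<bar>x a - l\<bar> \<le> 0" for a .
      then have "0 \<in> ?D" by simp
      then show False using \<open>?D = {}\<close> by blast
    qed
    moreover have "inf u v \<in> ?D" if "u \<in> ?D" "v \<in> ?D" for u v
      using that by (auto elim: eventually_elim2)
    then have "\<exists>w\<in>?D. (u, w) \<in> ?s \<and> (v, w) \<in> ?s" if "u \<in> ?D" "v \<in> ?D" for u v
      using that by (intro bexI[of _ "inf u v"]) auto
    moreover have "preorder_on ?D ?s"
      unfolding preorder_on_def refl_on_def trans_def by auto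
    ultimately have "directed_set ?D ?s" unfolding directed_set_def by blast
    moreover have "decreases_to_zero ?D ?s (\<lambda>u. u)"
      using glb unfolding decreases_to_zero_def by auto
    ultimately show "order_converges A r x l"
      by (rule order_convergesI) (auto simp: eventually_net_filter[OF dir])
  }
qed

text \<open>
  The net \<open>w\<close> is uo-convergent to \<open>0\<close>, expressed through the infimum of the eventual bounds of each
  truncation.
\<close>

definition uo_null :: "'i filter \<Rightarrow> ('i \<Rightarrow> 'a::vector_lattice) \<Rightarrow> bool" where
  "uo_null F w \<longleftrightarrow> (\<forall>y\<ge>0. isGlb UNIV {d. \<forall>\<^sub>F a in F. inf \<bar>w a\<bar> y \<le> d} 0)"

lemma uo_converges_iff_uo_null:
  assumes "directed_set A r"
  shows "uo_converges A r x l \<longleftrightarrow> uo_null (net_filter A r) (\<lambda>a. x a - l)"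
  unfolding uo_converges_def uo_null_def order_converges_iff_isGlb[OF assms]
  by simp

lemma uo_Cauchy_iff_uo_null:
  assumes "directed_set A r"
  shows "uo_Cauchy A r x \<longleftrightarrow>
    uo_null (net_filter A r \<times>\<^sub>F net_filter A r) (\<lambda>(a, b). x a - x b)"
  unfolding uo_Cauchy_def uo_converges_iff_uo_null[OF directed_set_product[OF assms]]
  by (simp add: net_filter_product[OF assms])

lemma uo_nullD:
  assumes "uo_null F w" "0 \<le> y" "\<And>d. \<forall>\<^sub>F a in F. inf \<bar>w a\<bar> y \<le> d \<Longrightarrow> c \<le> d"
  shows "c \<le> 0"
proof -
  have "isGlb UNIV {d. \<forall>\<^sub>F a in F. inf \<bar>w a\<bar> y \<le> d} 0"
    using assms(1,2) unfolding uo_null_def by blast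
  moreover have "isLb UNIV {d. \<forall>\<^sub>F a in F. inf \<bar>w a\<bar> y \<le> d} c"
    using assms(3) by (auto intro!: isLbI setgeI)
  ultimately show ?thesis using isGlb_le_isLb by blast
qed

lemma uo_nullI:
  assumes "F \<noteq> bot"
    and "\<And>y c. \<lbrakk>0 \<le> y; \<And>d. \<forall>\<^sub>F a in F. inf \<bar>w a\<bar> y \<le> d \<Longrightarrow> c \<le> d\<rbrakk> \<Longrightarrow> c \<le> 0"
  shows "uo_null F w"
  unfolding uo_null_def
proof (intro allI impI isGlbI2 isLbI setgeI setleI ballI)
  fix y d :: 'b assume y: "0 \<le> y" and "d \<in> {d. \<forall>\<^sub>F a in F. inf \<bar>w a\<bar> y \<le> d}"
  then obtain a where "inf \<bar>w a\<bar> y \<le> d"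
    using assms(1) eventually_happens' by blast
  moreover have "0 \<le> inf \<bar>w a\<bar> y" using y by simp
  ultimately show "0 \<le> d" by (rule order_trans[rotated])
next
  fix y c :: 'b
  assume y: "0 \<le> y" and c: "c \<in> Collect (isLb UNIV {d. \<forall>\<^sub>F a in F. inf \<bar>w a\<bar> y \<le> d})"
  show "c \<le> 0"
    by (rule assms(2)[OF y]) (use c isLbD in blast)
qed auto

lemma uo_null_mono:
  assumes "F \<noteq> bot" and w: "uo_null F w" and le: "\<And>a. \<bar>w' a\<bar> \<le> \<bar>w a\<bar>"
  shows "uo_null F w'"
proof (rule uo_nullI[OF \<open>F \<noteq> bot\<close>])
  fix y c :: 'b
  assume y: "0 \<le> y" and c: "\<And>d. \<forall>\<^sub>F a in F. inf \<bar>w' a\<bar> y \<le> d \<Longrightarrow> c \<le> d"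
  show "c \<le> 0"
  proof (rule uo_nullD[OF w y])
    fix d assume "\<forall>\<^sub>F a in F. inf \<bar>w a\<bar> y \<le> d"
    then have "\<forall>\<^sub>F a in F. inf \<bar>w' a\<bar> y \<le> d"
      by (rule eventually_mono) (meson inf_mono le order_refl order_trans)
    then show "c \<le> d" by (rule c)
  qed
qed

lemma uo_null_diff:
  assumes "F \<noteq> bot" and v: "uo_null F v" and w: "uo_null F w"
  shows "uo_null F (\<lambda>a. v a - w a)"
proof (rule uo_nullI[OF \<open>F \<noteq> bot\<close>])
  fix y c :: 'b
  assume y: "0 \<le> y" and c: "\<And>d. \<forall>\<^sub>F a in F. inf \<bar>v a - w a\<bar> y \<le> d \<Longrightarrow> c \<le> d"
  show "c \<le> 0"
  proof (rule uo_nullD[OF v y])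
    fix d assume d: "\<forall>\<^sub>F a in F. inf \<bar>v a\<bar> y \<le> d"
    have "c - d \<le> 0"
    proof (rule uo_nullD[OF w y])
      fix e assume "\<forall>\<^sub>F a in F. inf \<bar>w a\<bar> y \<le> e"
      with d have "\<forall>\<^sub>F a in F. inf \<bar>v a - w a\<bar> y \<le> d + e"
      proof eventually_elim
        case (elim a)
        have "inf \<bar>v a - w a\<bar> y \<le> inf (\<bar>v a\<bar> + \<bar>w a\<bar>) y"
          by (intro inf_mono abs_triangle_ineq4) simp
        also have "\<dots> \<le> inf \<bar>v a\<bar> y + inf \<bar>w a\<bar> y" using y by (intro inf_add_le) auto
        also have "\<dots> \<le> d + e" using elim by (intro add_mono)
        finally show ?case .
      qed
      then show "c - d \<le> e" using c by (simp add: diff_le_eq add.commute)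
    qed
    then show "c \<le> d" by simp
  qed
qed

section \<open>Suprema as unbounded order limits\<close>

text \<open>
  Subtracting the positive part of \<open>c\<close> turns an upper bound of \<open>Z\<close> into another one. Iterating this
  keeps all its multiples below a fixed element.
\<close>

lemma archimedean_gap_le_zero:
  fixes Z :: "'a::vector_lattice set"
  assumes arch: "archimedean TYPE('a)" and ne: "z0 \<in> Z" "\<forall>z\<in>Z. z \<le> u0"
    and gap: "\<And>u z. \<lbrakk>\<forall>z\<in>Z. z \<le> u; z \<in> Z\<rbrakk> \<Longrightarrow> c \<le> u - z"
  shows "c \<le> 0"
proof -
  let ?p = "pprt c"
  have gap_p: "?p \<le> u - z" if "\<forall>z\<in>Z. z \<le> u" "z \<in> Z" for u z
    using gap[OF that] that by (simp add: pprt_def)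
  have ub: "\<forall>z\<in>Z. z \<le> u0 - real n *\<^sub>R ?p" for n
  proof (induction n)
    case (Suc n)
    then have "?p \<le> (u0 - real n *\<^sub>R ?p) - z" if "z \<in> Z" for z
      using gap_p that by blast
    then show ?case by (simp add: algebra_simps)
  qed (use ne in simp)
  have "real n *\<^sub>R ?p \<le> u0 - z0" for n
    using ub[of n] ne(1) by (simp add: algebra_simps)
  then have "?p = 0" using arch unfolding archimedean_def by (metis zero_le_pprt)
  then show ?thesis by (simp add: le_zero_iff_zero_pprt)
qed

text \<open>
  If the limit missed a member of the net from below, or an upper bound from above, the positive
  part of the gap would stay below the distance to the limit along a tail.
\<close>

lemma isLub_of_monotone_uo_limit:
  fixes x :: "'i \<Rightarrow> 'a::vector_lattice"
  assumes dir: "directed_set A r"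
    and mono: "\<And>a b. (a, b) \<in> r \<Longrightarrow> x a \<le> x b"
    and lim: "uo_converges A r x l"
  shows "isLub UNIV (x ` A) l"
proof -
  note ev = eventually_net_filter[OF dir]
  have null: "uo_null (net_filter A r) (\<lambda>a. x a - l)"
    using lim unfolding uo_converges_iff_uo_null[OF dir] .
  \<comment> \<open>Tested against its own height, a gap that persists along the net is null.\<close>
  have le_zero: "c \<le> 0" if c: "\<forall>\<^sub>F b in net_filter A r. c \<le> \<bar>x b - l\<bar>" for c
  proof -
    have "pprt c \<le> 0"
    proof (rule uo_nullD[OF null])
      fix d assume "\<forall>\<^sub>F b in net_filter A r. inf \<bar>x b - l\<bar> (pprt c) \<le> d"
      with c have "\<forall>\<^sub>F b in net_filter A r. pprt c \<le> d"
      proof eventually_elim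
        case (elim b)
        have "pprt c \<le> inf \<bar>x b - l\<bar> (pprt c)"
          using elim(1) by (simp add: pprt_def)
        then show ?case using elim(2) by (rule order_trans)
      qed
      then show "pprt c \<le> d"
        using eventually_happens'[OF net_filter_neq_bot[OF dir]] by blast
    qed simp
    then show ?thesis by (simp add: le_zero_iff_zero_pprt)
  qed
  show ?thesis
  proof (intro isLubI2 isUb_UNIV_I setgeI ballI)
    fix y assume "y \<in> x ` A"
    then obtain a where a: "a \<in> A" "y = x a" by blast
    have "y - l \<le> \<bar>x b - l\<bar>" if "(a, b) \<in> r" for b
    proof -
      have "y - l \<le> x b - l" using mono[OF that] a by simp
      then show ?thesis using abs_ge_self order_trans by blast
    qed
    then have "y - l \<le> 0" using a by (intro le_zero) (auto simp: ev)
    then show "y \<le> l" by simp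
  next
    fix u assume "u \<in> Collect (isUb UNIV (x ` A))"
    then have u: "x b \<le> u" if "b \<in> A" for b using that by (simp add: isUbD)
    have "l - u \<le> \<bar>x b - l\<bar>" if "b \<in> A" for b
    proof -
      have "l - u \<le> l - x b" using u[OF that] by (intro diff_left_mono)
      also have "\<dots> \<le> \<bar>x b - l\<bar>" using abs_ge_minus_self[of "x b - l"] by simp
      finally show ?thesis .
    qed
    then have "l - u \<le> 0"
      using dir by (intro le_zero) (auto simp: ev directed_set_def)
    then show "l \<le> u" by simp
  qed
qed

text \<open>
  Beyond an index \<open>k\<close>, any two members of an increasing net differ by at most \<open>x m - x k\<close> for some
  later \<open>m\<close>. After truncation at \<open>y\<close> this is at most \<open>z m - z k\<close>, a gap of a bounded net, and so
  every difference between an upper bound and a member of \<open>z\<close> is an eventual bound. The auxiliary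
  net \<open>z\<close> may depend on \<open>y\<close>: this is what admits unbounded nets, with the truncation of \<open>x\<close> at
  \<open>y\<close> as \<open>z\<close>.
\<close>

lemma isLub_of_monotone_net:
  fixes x :: "'i \<Rightarrow> 'a::vector_lattice"
  assumes arch: "archimedean TYPE('a)" and complete: "uo_complete TYPE('a)"
    and dir: "directed_set A r"
    and mono: "\<And>a b. (a, b) \<in> r \<Longrightarrow> x a \<le> x b"
    and bounded: "\<And>y. 0 \<le> y \<Longrightarrow> \<exists>z u. (\<forall>a\<in>A. z a \<le> u) \<and>
      (\<forall>(a, b)\<in>r. inf (x b - x a) y \<le> z b - z a)"
  shows "\<exists>s. isLub UNIV (x ` A) s"
proof -
  let ?F = "net_filter A r"
  have trn: "(a, c) \<in> r" if "(a, b) \<in> r" "(b, c) \<in> r" for a b c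
    using dir that unfolding directed_set_def preorder_on_def trans_def by blast
  obtain a0 where a0: "a0 \<in> A" using dir unfolding directed_set_def by blast
  have "uo_null (?F \<times>\<^sub>F ?F) (\<lambda>(a, b). x a - x b)"
  proof (rule uo_nullI)
    show "?F \<times>\<^sub>F ?F \<noteq> bot" using net_filter_neq_bot[OF dir] by (simp add: prod_filter_eq_bot)
    fix y c :: 'a
    assume y: "0 \<le> y"
      and c: "\<And>d. \<forall>\<^sub>F p in ?F \<times>\<^sub>F ?F. inf \<bar>case p of (a, b) \<Rightarrow> x a - x b\<bar> y \<le> d \<Longrightarrow> c \<le> d"
    obtain z u0 where u0: "\<forall>a\<in>A. z a \<le> u0"
      and z: "\<And>a b. (a, b) \<in> r \<Longrightarrow> inf (x b - x a) y \<le> z b - z a"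
      using bounded[OF y] by blast
    show "c \<le> 0"
    proof (rule archimedean_gap_le_zero[OF arch])
      show "z a0 \<in> z ` A" "\<forall>v\<in>z ` A. v \<le> u0" using a0 u0 by auto
      fix u v assume u: "\<forall>v\<in>z ` A. v \<le> u" and "v \<in> z ` A"
      then obtain k where k: "k \<in> A" "v = z k" by blast
      show "c \<le> u - v"
      proof (rule c, unfold eventually_prod_same, intro exI conjI allI impI)
        show "\<forall>\<^sub>F a in ?F. a \<in> A \<and> (k, a) \<in> r"
          unfolding eventually_net_filter[OF dir] using k by blast
        fix a b assume ab: "a \<in> A \<and> (k, a) \<in> r" "b \<in> A \<and> (k, b) \<in> r"
        then obtain m where m: "m \<in> A" "(a, m) \<in> r" "(b, m) \<in> r"
          using dir unfolding directed_set_def by blast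
        have le: "x k \<le> x a" "x k \<le> x b" "x a \<le> x m" "x b \<le> x m" using ab m mono by auto
        have "\<bar>x a - x b\<bar> \<le> x m - x k"
          using diff_mono[OF le(3,2)] diff_mono[OF le(4,1)] by (intro abs_leI) auto
        then have "inf \<bar>x a - x b\<bar> y \<le> inf (x m - x k) y" by (rule inf_mono) simp
        also have "\<dots> \<le> z m - z k" using z trn ab m by blast
        also have "\<dots> \<le> u - v" using u m k by (intro diff_mono) auto
        finally show "inf \<bar>case (a, b) of (a, b) \<Rightarrow> x a - x b\<bar> y \<le> u - v" by simp
      qed
    qed
  qed
  then have "uo_Cauchy A r x" unfolding uo_Cauchy_iff_uo_null[OF dir] .
  then obtain l where "uo_converges A r x l" using uo_completeD[OF complete dir] by blast
  then show ?thesis using isLub_of_monotone_uo_limit[of A r x l] dir mono by blast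
qed

lemma directed_finite_subsets:
  assumes "F0 \<in> \<F>" "\<And>F. F \<in> \<F> \<Longrightarrow> finite F"
    "\<And>F G. \<lbrakk>F \<in> \<F>; G \<in> \<F>\<rbrakk> \<Longrightarrow> F \<union> G \<in> \<F>"
  shows "directed_set \<F> {(F, G). F \<in> \<F> \<and> G \<in> \<F> \<and> F \<subseteq> G}"
  unfolding directed_set_def preorder_on_def refl_on_def trans_def
  using assms by (auto intro!: bexI[of _ "_ \<union> _"])

lemma uo_complete_imp_order_complete:
  assumes arch: "archimedean TYPE('a::vector_lattice)" and complete: "uo_complete TYPE('a)"
  shows "order_complete TYPE('a)"
  unfolding order_complete_def
proof (intro allI impI)
  fix S :: "'a set" assume "S \<noteq> {}" and "bdd_above S"
  then obtain s0 u where s0: "s0 \<in> S" and u: "\<And>s. s \<in> S \<Longrightarrow> s \<le> u"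
    unfolding bdd_above_def by blast
  define \<F> where "\<F> = {F. finite F \<and> F \<noteq> {} \<and> F \<subseteq> S}"
  let ?r = "{(F, G). F \<in> \<F> \<and> G \<in> \<F> \<and> F \<subseteq> G}"
  have "directed_set \<F> ?r"
    by (rule directed_finite_subsets[of "{s0}"]) (use s0 in \<open>auto simp: \<F>_def\<close>)
  moreover have "Sup_fin F \<le> Sup_fin G" if "(F, G) \<in> ?r" for F G
    using that by (intro Sup_fin.subset_imp) (auto simp: \<F>_def)
  moreover have le_u: "\<forall>F\<in>\<F>. Sup_fin F \<le> v" if "\<And>s. s \<in> S \<Longrightarrow> s \<le> v" for v
    using that by (auto simp: \<F>_def intro!: Sup_fin.boundedI)
  then have "\<exists>z v. (\<forall>F\<in>\<F>. z F \<le> v) \<and>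
      (\<forall>(F, G)\<in>?r. inf (Sup_fin G - Sup_fin F) y \<le> z G - z F)" for y :: 'a
    using u by (intro exI[of _ Sup_fin] exI[of _ u]) auto
  ultimately obtain l where l: "isLub UNIV (Sup_fin ` \<F>) l"
    using isLub_of_monotone_net[OF arch complete, of \<F> ?r Sup_fin] by blast
  have "isLub UNIV S l"
  proof (intro isLubI2 isUb_UNIV_I setgeI ballI)
    fix s assume "s \<in> S"
    then have "Sup_fin {s} \<in> Sup_fin ` \<F>" by (intro imageI) (auto simp: \<F>_def)
    then show "s \<le> l" using isLubD2[OF l] by fastforce
  next
    fix v assume "v \<in> Collect (isUb UNIV S)"
    then have "\<forall>F\<in>\<F>. Sup_fin F \<le> v" by (intro le_u) (simp add: isUbD)
    then show "l \<le> v" by (intro isLub_le_isUb[OF l] isUb_UNIV_I) auto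
  qed
  then show "\<exists>s. isLub UNIV S s" ..
qed

text \<open>
  Adding a disjoint element amounts to taking a supremum.
\<close>

lemma disjoint_sum_le:
  fixes F :: "'a::lattice_ab_group_add set"
  assumes "finite F" "\<forall>v\<in>F. 0 \<le> v" "pairwise (\<lambda>v w. inf v w = 0) F" "0 \<le> u" "\<forall>v\<in>F. v \<le> u"
  shows "\<Sum>F \<le> u"
  using assms
proof (induction F rule: finite_induct)
  case (insert v F)
  have "inf w v = 0" if "w \<in> F" for w
    using insert.prems(2) insert.hyps(2) that by (auto simp: pairwise_def)
  then have "inf (\<Sum>F) v = 0" using insert.prems(1) by (intro disjoint_sum) auto
  then have "v + \<Sum>F = sup v (\<Sum>F)" using add_eq_inf_sup[of v "\<Sum>F"] by (simp add: inf_commute)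
  also have "\<dots> \<le> u"
    using insert by (auto simp: pairwise_insert)
  finally show ?case using insert.hyps by simp
qed simp

text \<open>
  Unlike in the order-bounded case, the net of finite sums may be unbounded. If \<open>F\<close> is a subset of
  \<open>G\<close>, then the sums over \<open>F\<close> and over \<open>G - F\<close> are disjoint, and their truncations at \<open>y\<close> add up to
  at most the truncation of the sum over \<open>G\<close>.
\<close>

lemma uo_complete_imp_laterally_complete:
  assumes arch: "archimedean TYPE('a::vector_lattice)" and complete: "uo_complete TYPE('a)"
  shows "laterally_complete TYPE('a)"
  unfolding laterally_complete_def
proof (intro allI impI)
  fix S :: "'a set"
  assume "S \<noteq> {}" and pos: "\<forall>v\<in>S. 0 \<le> v" and disj: "pairwise (\<lambda>v w. inf v w = 0) S"
  define \<F> where "\<F> = {F. finite F \<and> F \<subseteq> S}"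
  let ?r = "{(F, G). F \<in> \<F> \<and> G \<in> \<F> \<and> F \<subseteq> G}"
  have nonneg: "0 \<le> \<Sum>F" if "F \<in> \<F>" for F
    using that pos by (intro sum_nonneg) (auto simp: \<F>_def)
  have "directed_set \<F> ?r"
    by (rule directed_finite_subsets[of "{}"]) (auto simp: \<F>_def)
  moreover have "\<Sum>F \<le> \<Sum>G" if "(F, G) \<in> ?r" for F G
    using that pos by (intro sum_mono2) (auto simp: \<F>_def)
  moreover have "\<exists>z u. (\<forall>F\<in>\<F>. z F \<le> u) \<and>
      (\<forall>(F, G)\<in>?r. inf (\<Sum>G - \<Sum>F) y \<le> z G - z F)" if y: "0 \<le> y" for y :: 'a
  proof (intro exI conjI ballI)
    show "inf (\<Sum>F) y \<le> y" for F by simp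
    fix p assume "p \<in> ?r"
    then obtain F G where p: "p = (F, G)" and FG: "F \<in> \<F>" "G \<in> \<F>" "F \<subseteq> G" by blast
    then have D: "G - F \<in> \<F>" by (auto simp: \<F>_def)
    have split: "\<Sum>G = \<Sum>(G - F) + \<Sum>F"
      using FG by (simp add: sum.subset_diff \<F>_def)
    have "inf v (\<Sum>F) = 0" if v: "v \<in> G - F" for v
    proof -
      have "inf w v = 0" if "w \<in> F" for w
        using disj by (rule pairwiseD) (use that v FG in \<open>auto simp: \<F>_def\<close>)
      then have "inf (\<Sum>F) v = 0"
        using pos v FG by (intro disjoint_sum) (auto simp: \<F>_def)
      then show ?thesis by (simp only: inf_commute)
    qed
    then have "inf (\<Sum>(G - F)) (\<Sum>F) = 0" by (intro disjoint_sum nonneg FG)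
    then have "inf (inf (\<Sum>(G - F)) y) (inf (\<Sum>F) y) = 0"
      by (rule disjoint_mono) (use nonneg[OF D] nonneg[OF FG(1)] y in auto)
    then have "inf (\<Sum>(G - F)) y + inf (\<Sum>F) y = sup (inf (\<Sum>(G - F)) y) (inf (\<Sum>F) y)"
      using add_eq_inf_sup[of "inf (\<Sum>(G - F)) y" "inf (\<Sum>F) y"] by simp
    also have "\<dots> \<le> inf (\<Sum>G) y"
      unfolding split using nonneg[OF D] nonneg[OF FG(1)]
      by (intro sup_least inf_mono) auto
    finally have "inf (\<Sum>(G - F)) y \<le> inf (\<Sum>G) y - inf (\<Sum>F) y" by (simp only: le_diff_eq)
    then show "case p of (F, G) \<Rightarrow> inf (\<Sum>G - \<Sum>F) y \<le> inf (\<Sum>G) y - inf (\<Sum>F) y"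
      by (simp only: p prod.case split add_diff_cancel_right')
  qed
  ultimately obtain l where l: "isLub UNIV (Sum ` \<F>) l"
    using isLub_of_monotone_net[OF arch complete, of \<F> ?r Sum] by blast
  have "isLub UNIV S l"
  proof (intro isLubI2 isUb_UNIV_I setgeI ballI)
    fix v assume "v \<in> S"
    then have "\<Sum>{v} \<in> Sum ` \<F>" by (intro imageI) (auto simp: \<F>_def)
    then show "v \<le> l" using isLubD2[OF l] by fastforce
  next
    fix u assume "u \<in> Collect (isUb UNIV S)"
    then have u: "\<forall>v\<in>S. v \<le> u" by (simp add: isUbD)
    then have "0 \<le> u" using pos \<open>S \<noteq> {}\<close> by (meson all_not_in_conv order_trans)
    then have "\<Sum>F \<le> u" if "F \<in> \<F>" for F
      using that pos u pairwise_subset[OF disj] by (intro disjoint_sum_le) (auto simp: \<F>_def)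
    then show "l \<le> u" by (intro isLub_le_isUb[OF l] isUb_UNIV_I) auto
  qed
  then show "\<exists>s. isLub UNIV S s" ..
qed

section \<open>Unbounded order limits in a universally complete space\<close>

text \<open>
  The hypothesis says that \<open>g\<close> exceeds every multiple of \<open>p\<close> wherever \<open>p\<close> is positive. Formally, the
  part of \<open>n p\<close> above \<open>g\<close> lies below \<open>n p\<close> and is disjoint from it, hence zero.
\<close>

lemma archimedean_pprt_diff_scaleR:
  fixes g p :: "'a::vector_lattice"
  assumes arch: "archimedean TYPE('a)" and "0 \<le> p" "0 \<le> g"
    and le: "\<And>n. p \<le> pprt (g - real n *\<^sub>R p)"
  shows "p = 0"
proof -
  have "real n *\<^sub>R p \<le> g" for n
  proof -
    let ?t = "g - real n *\<^sub>R p"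
    have "real n *\<^sub>R p \<ge> 0" using \<open>0 \<le> p\<close> by (simp add: scaleR_nonneg_nonneg)
    have "inf p (pprt (- ?t)) = 0"
      using disjoint_mono[OF disjoint_pprt_uminus \<open>0 \<le> p\<close> le[of n]] by simp
    then have disj: "inf (real n *\<^sub>R p) (pprt (- ?t)) = 0" by (rule disjoint_scaleR)
    have "pprt (- ?t) \<le> real n *\<^sub>R p"
      using \<open>0 \<le> g\<close> \<open>real n *\<^sub>R p \<ge> 0\<close> by (simp add: pprt_def)
    then have "pprt (- ?t) = 0" using disj by (simp add: inf_absorb2)
    then have "- ?t \<le> 0" by (simp only: le_zero_iff_zero_pprt)
    then show ?thesis by simp
  qed
  then show ?thesis using arch \<open>0 \<le> p\<close> unfolding archimedean_def by blast
qed

text \<open>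
  If the part of \<open>g\<close> above \<open>b\<close> is disjoint from \<open>v\<close>, then \<open>b\<close> bounds \<open>g\<close> on the band of \<open>v\<close>. The
  projection of \<open>b\<close> to this band is the supremum \<open>s v\<close> of the elements \<open>inf (n v) b\<close>. For a maximal
  disjoint family of such \<open>v\<close>, the projections are disjoint, and their supremum \<open>h\<close> bounds \<open>G\<close>: by
  maximality, a nonzero part of some \<open>g\<close> above \<open>h\<close> meets a member \<open>v\<close> of the family in an element
  \<open>p\<close>, below which \<open>g\<close> does not exceed \<open>b\<close> and therefore exceeds all multiples of \<open>v\<close>.
\<close>

lemma bdd_above_of_locally_bounded:
  fixes G :: "'a::vector_lattice set"
  assumes arch: "archimedean TYPE('a)" and univ: "universally_complete TYPE('a)"
    and dense: "\<And>e. 0 < e \<Longrightarrow> \<exists>v b. 0 < v \<and> v \<le> e \<and> 0 \<le> b \<and> (\<forall>g\<in>G. inf (pprt (g - b)) v = 0)"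
  shows "bdd_above G"
proof -
  define good where "good v b \<longleftrightarrow> 0 < v \<and> 0 \<le> b \<and> (\<forall>g\<in>G. inf (pprt (g - b)) v = 0)" for v b
  define \<V> where "\<V> = {V. (\<forall>v\<in>V. \<exists>b. good v b) \<and> pairwise (\<lambda>v w. inf v w = 0) V}"
  have "\<Union>C \<in> \<V>" if "subset.chain \<V> C" for C
  proof -
    have C: "C \<subseteq> \<V>" and chain: "\<And>U W. \<lbrakk>U \<in> C; W \<in> C\<rbrakk> \<Longrightarrow> U \<subseteq> W \<or> W \<subseteq> U"
      using that unfolding pred_on.chain_def by blast+
    have "inf v w = 0" if vw: "v \<in> \<Union>C" "w \<in> \<Union>C" "v \<noteq> w" for v w
    proof -
      obtain U where "U \<in> C" "v \<in> U" "w \<in> U" using vw(1,2) chain by blast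
      then show ?thesis using C vw(3) by (auto simp: \<V>_def pairwise_def)
    qed
    then show ?thesis using C by (auto simp: \<V>_def pairwise_def)
  qed
  then obtain V where V: "V \<in> \<V>" and max: "\<And>W. \<lbrakk>W \<in> \<V>; V \<subseteq> W\<rbrakk> \<Longrightarrow> W = V"
    using subset_Zorn'[of \<V>] by blast
  have "\<forall>v\<in>V. \<exists>b. good v b" using V unfolding \<V>_def by simp
  then obtain b where b: "\<And>v. v \<in> V \<Longrightarrow> good v (b v)" using bchoice by meson
  have b_nonneg: "0 \<le> b v" if "v \<in> V" for v using b[OF that] by (simp add: good_def)
  have V_nonneg: "0 \<le> v" if "v \<in> V" for v using b[OF that] by (simp add: good_def order_less_imp_le)
  have "\<exists>s. isLub UNIV (range (\<lambda>n. inf (real n *\<^sub>R v) (b v))) s" for v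
  proof -
    have "bdd_above (range (\<lambda>n. inf (real n *\<^sub>R v) (b v)))" by (auto intro!: bdd_aboveI[of _ "b v"])
    then show ?thesis
      using univ unfolding universally_complete_def order_complete_def by blast
  qed
  then obtain s where s: "\<And>v. isLub UNIV (range (\<lambda>n. inf (real n *\<^sub>R v) (b v))) (s v)" by metis
  have s_ge: "inf (real n *\<^sub>R v) (b v) \<le> s v" for n v using isLubD2[OF s] by blast
  have s_disj: "inf (s v) c = 0" if "v \<in> V" "inf v c = 0" for v c
  proof (rule disjoint_isLub[OF s])
    have "0 \<le> c" using that by (metis inf_le2)
    fix x assume "x \<in> range (\<lambda>n. inf (real n *\<^sub>R v) (b v))"
    then obtain n where x: "x = inf (real n *\<^sub>R v) (b v)" by blast
    have "inf (real n *\<^sub>R v) c = 0" by (rule disjoint_scaleR[OF that(2)])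
    then show "inf x c = 0"
      by (rule disjoint_mono)
        (use x b_nonneg[OF that(1)] V_nonneg[OF that(1)] \<open>0 \<le> c\<close> in \<open>auto simp: scaleR_nonneg_nonneg\<close>)
  qed auto
  have s_nonneg: "0 \<le> s v" if "v \<in> V" for v
    using s_ge[of 0 v] b_nonneg[OF that] by (simp add: inf_absorb1)
  \<comment> \<open>Adding \<open>0\<close> covers the case that \<open>V\<close> is empty.\<close>
  have "pairwise (\<lambda>x y. inf x y = 0) (insert 0 (s ` V))"
  proof -
    have "inf (s v) (s w) = 0" if "v \<in> V" "w \<in> V" "s v \<noteq> s w" for v w
    proof -
      have "inf v w = 0" using V that by (auto simp: \<V>_def pairwise_def)
      then have "inf w (s v) = 0" using s_disj[OF that(1)] by (simp add: inf_commute)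
      then show ?thesis using s_disj[OF that(2)] by (simp add: inf_commute)
    qed
    then show ?thesis
      using s_nonneg by (auto simp: pairwise_def inf_absorb1 inf_absorb2)
  qed
  moreover have "\<forall>x\<in>insert 0 (s ` V). 0 \<le> x" using s_nonneg by auto
  ultimately obtain h where h: "isLub UNIV (insert 0 (s ` V)) h"
    using univ unfolding universally_complete_def laterally_complete_def
    by (metis insert_not_empty)
  have h_ge: "s v \<le> h" if "v \<in> V" for v using isLubD2[OF h] that by auto
  have "g \<le> h" if g: "g \<in> G" for g
  proof (rule ccontr)
    assume "\<not> g \<le> h"
    let ?e = "pprt (g - h)"
    have "?e \<noteq> 0" using \<open>\<not> g \<le> h\<close> by (simp flip: le_zero_iff_zero_pprt)
    then have "0 < ?e" by (simp add: order_less_le)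
    have "\<exists>v\<in>V. inf ?e v \<noteq> 0"
    proof (rule ccontr)
      assume "\<not> ?thesis"
      then have disj: "\<forall>v\<in>V. inf ?e v = 0" by blast
      obtain w where w: "0 < w" "w \<le> ?e" "\<exists>b. good w b"
        using dense[OF \<open>0 < ?e\<close>] unfolding good_def by blast
      have wV: "inf w v = 0" if "v \<in> V" for v
        by (rule disjoint_mono[OF disj[rule_format, OF that]]) (use w V_nonneg[OF that] in auto)
      have "insert w V \<in> \<V>"
        using V w(3) wV by (auto simp: \<V>_def pairwise_insert inf_commute)
      then have "w \<in> V" using max by blast
      then show False using wV[of w] w(1) by simp
    qed
    then obtain v where v: "v \<in> V" and ne: "inf ?e v \<noteq> 0" by blast
    let ?p = "inf ?e v"
    have p_nonneg: "0 \<le> ?p" using V_nonneg[OF v] by simp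
    have "?p = 0"
    proof (rule archimedean_pprt_diff_scaleR[OF arch p_nonneg])
      fix n
      \<comment> \<open>The comparison with multiples of \<open>p\<close> needs a nonnegative element in place of \<open>g\<close>.\<close>
      let ?q = "pprt (pprt g - real n *\<^sub>R ?p)"
      have "g - h \<le> g - inf (real n *\<^sub>R v) (b v)"
        using order_trans[OF s_ge h_ge[OF v]] by (intro diff_left_mono)
      also have "\<dots> = sup (g - real n *\<^sub>R v) (g - b v)"
        by (simp add: add_sup_distrib_left)
      also have "\<dots> \<le> pprt (g - real n *\<^sub>R v) + pprt (g - b v)"
        by (intro sup_least add_increasing add_increasing2) (auto simp: pprt_def)
      also have "\<dots> \<le> ?q + pprt (g - b v)"
      proof (intro add_right_mono pprt_mono diff_mono)
        show "g \<le> pprt g" by (simp add: pprt_def)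
        show "real n *\<^sub>R ?p \<le> real n *\<^sub>R v" by (intro scaleR_left_mono) auto
      qed
      finally have "?e \<le> ?q + pprt (g - b v)" by (simp add: pprt_def[of "g - h"])
      then have "?p \<le> inf (?q + pprt (g - b v)) v" by (rule inf_mono) simp
      also have "\<dots> \<le> inf ?q v + inf (pprt (g - b v)) v"
        using V_nonneg[OF v] by (intro inf_add_le) auto
      also have "\<dots> = inf ?q v" using b[OF v] g by (simp add: good_def)
      finally show "?p \<le> ?q" by simp
    qed simp
    then show False using ne by blast
  qed
  then show ?thesis by (rule bdd_aboveI)
qed

text \<open>
  The local bound near \<open>e\<close> is \<open>x k + e\<close> for an index \<open>k\<close> far enough along the filter, on the
  nonzero element \<open>pprt (e - d)\<close>, where \<open>d\<close> is an eventual bound of the differences truncated at \<open>e\<close>.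
\<close>

lemma eventual_lower_bounds_bdd_above:
  fixes x :: "'i \<Rightarrow> 'a::vector_lattice"
  assumes arch: "archimedean TYPE('a)" and univ: "universally_complete TYPE('a)"
    and F: "F \<noteq> bot" and nonneg: "\<And>a. 0 \<le> x a"
    and Cauchy: "uo_null (F \<times>\<^sub>F F) (\<lambda>(a, b). x a - x b)"
  shows "bdd_above {c. \<forall>\<^sub>F a in F. c \<le> x a}"
proof (rule bdd_above_of_locally_bounded[OF arch univ])
  fix e :: 'a assume e: "0 < e"
  \<comment> \<open>Otherwise \<open>e\<close> would be a lower bound of all eventual bounds, whose infimum is \<open>0\<close>.\<close>
  have "\<exists>d. (\<forall>\<^sub>F p in F \<times>\<^sub>F F. inf \<bar>case p of (a, b) \<Rightarrow> x a - x b\<bar> e \<le> d) \<and> \<not> e \<le> d"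
  proof (rule ccontr)
    assume "\<not> ?thesis"
    then have "e \<le> 0" using e by (intro uo_nullD[OF Cauchy, of e]) auto
    then show False using e by simp
  qed
  then obtain d Q where Q: "eventually Q F" "\<And>a b. \<lbrakk>Q a; Q b\<rbrakk> \<Longrightarrow> inf \<bar>x a - x b\<bar> e \<le> d"
    and d: "\<not> e \<le> d"
    unfolding eventually_prod_same by fastforce
  obtain k where k: "Q k" using eventually_happens'[OF F Q(1)] by blast
  have "inf \<bar>x k - x k\<bar> e \<le> d" by (rule Q(2)[OF k k])
  then have "0 \<le> d" using e by (simp add: inf_absorb1)
  let ?v = "pprt (e - d)"
  have "?v \<noteq> 0" using d by (simp flip: le_zero_iff_zero_pprt)
  then have "0 < ?v" by (simp add: order_less_le)
  moreover have "?v \<le> e" using e \<open>0 \<le> d\<close> by (simp add: pprt_def diff_le_eq)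
  moreover have "0 \<le> x k + e" using nonneg[of k] e by (simp add: add_nonneg_nonneg)
  moreover have "inf (pprt (c - (x k + e))) ?v = 0" if c: "\<forall>\<^sub>F a in F. c \<le> x a" for c
  proof -
    obtain a where a: "Q a" "c \<le> x a"
      using eventually_happens'[OF F eventually_conj[OF Q(1) c]] by blast
    let ?t = "\<bar>x a - x k\<bar> - e"
    \<comment> \<open>Wherever the distance exceeds \<open>e\<close>, the truncated distance is \<open>e\<close>, so \<open>d\<close> is at least \<open>e\<close>.\<close>
    show ?thesis
    proof (rule disjoint_mono[OF disjoint_pprt_uminus[of ?t]])
      have "c - x k \<le> \<bar>x a - x k\<bar>"
        using diff_right_mono[OF a(2)] abs_ge_self order_trans by blast
      then have "c - (x k + e) \<le> ?t" by (simp add: algebra_simps)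
      then show "pprt (c - (x k + e)) \<le> pprt ?t" by (rule pprt_mono)
      have "e - d \<le> e - inf \<bar>x a - x k\<bar> e" using Q(2)[OF a(1) k] by (rule diff_left_mono)
      also have "\<dots> = pprt (- ?t)"
        by (simp add: pprt_def add_sup_distrib_left)
      finally show "pprt (e - d) \<le> pprt (- ?t)" by (simp add: pprt_def)
    qed auto
  qed
  ultimately show "\<exists>v b. 0 < v \<and> v \<le> e \<and> 0 \<le> b \<and>
      (\<forall>c\<in>{c. \<forall>\<^sub>F a in F. c \<le> x a}. inf (pprt (c - b)) v = 0)"
    by blast
qed

text \<open>
  Truncation at \<open>y + l\<close> instead of \<open>y\<close> leaves \<open>l\<close> and the elements below it unchanged. If the
  members of the net truncated in this way differ by at most \<open>d\<close> on a tail, then each of them lies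
  within \<open>d\<close> of the supremum \<open>l\<close> of the eventual lower bounds.
\<close>

lemma uo_limit_of_nonneg:
  fixes x :: "'i \<Rightarrow> 'a::vector_lattice"
  assumes arch: "archimedean TYPE('a)" and univ: "universally_complete TYPE('a)"
    and F: "F \<noteq> bot" and nonneg: "\<And>a. 0 \<le> x a"
    and Cauchy: "uo_null (F \<times>\<^sub>F F) (\<lambda>(a, b). x a - x b)"
  shows "\<exists>l. uo_null F (\<lambda>a. x a - l)"
proof -
  let ?L = "{c. \<forall>\<^sub>F a in F. c \<le> x a}"
  have "0 \<in> ?L" using nonneg by simp
  moreover have "bdd_above ?L" by (rule eventual_lower_bounds_bdd_above[OF assms])
  ultimately obtain l where l: "isLub UNIV ?L l"
    using univ unfolding universally_complete_def order_complete_def by (metis empty_iff)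
  have "0 \<le> l" using isLubD2[OF l \<open>0 \<in> ?L\<close>] .
  have "uo_null F (\<lambda>a. x a - l)"
  proof (rule uo_nullI[OF F])
    fix y c :: 'a
    assume y: "0 \<le> y" and c: "\<And>d. \<forall>\<^sub>F a in F. inf \<bar>x a - l\<bar> y \<le> d \<Longrightarrow> c \<le> d"
    let ?y = "y + l"
    have "0 \<le> ?y" using y \<open>0 \<le> l\<close> by simp
    show "c \<le> 0"
    proof (rule uo_nullD[OF Cauchy \<open>0 \<le> ?y\<close>])
      fix d assume "\<forall>\<^sub>F p in F \<times>\<^sub>F F. inf \<bar>case p of (a, b) \<Rightarrow> x a - x b\<bar> ?y \<le> d"
      then obtain Q where Q: "eventually Q F" "\<And>a b. \<lbrakk>Q a; Q b\<rbrakk> \<Longrightarrow> inf \<bar>x a - x b\<bar> ?y \<le> d"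
        unfolding eventually_prod_same by fastforce
      have close: "inf (x a) ?y \<le> inf (x b) ?y + d" if "Q a" "Q b" for a b
      proof -
        have "inf (x a) ?y - inf (x b) ?y \<le> \<bar>inf (x a) ?y - inf (x b) ?y\<bar>" by (rule abs_ge_self)
        also have "\<dots> \<le> inf \<bar>x a - x b\<bar> ?y" using nonneg \<open>0 \<le> ?y\<close> by (intro abs_inf_diff_le)
        also have "\<dots> \<le> d" by (rule Q(2)[OF that])
        finally show ?thesis by (simp only: diff_le_eq add.commute)
      qed
      have "inf \<bar>x a - l\<bar> y \<le> d" if a: "Q a" for a
      proof -
        have "inf (x a) ?y - d \<in> ?L"
        proof (simp only: mem_Collect_eq, rule eventually_mono[OF Q(1)])
          fix b assume "Q b"
          then have "inf (x a) ?y - d \<le> inf (x b) ?y" using close[OF a] by (simp only: diff_le_eq)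
          then show "inf (x a) ?y - d \<le> x b" by simp
        qed
        then have upper: "inf (x a) ?y - d \<le> l" using isLubD2[OF l] by blast
        have "e \<le> inf (x a) ?y + d" if e: "e \<in> ?L" for e
        proof -
          obtain b where b: "Q b" "e \<le> x b"
            using eventually_happens'[OF F eventually_conj[OF Q(1)]] e by blast
          have "e \<le> ?y" using isLubD2[OF l e] y by (simp add: add_increasing)
          then have "e \<le> inf (x b) ?y" using b by simp
          then show ?thesis using close[OF b(1) a] by (rule order_trans)
        qed
        then have lower: "l \<le> inf (x a) ?y + d" by (intro isLub_le_isUb[OF l] isUb_UNIV_I)
        have "inf \<bar>x a - l\<bar> y \<le> \<bar>inf (x a - l) y\<bar>" by (rule inf_abs_le_abs_inf[OF y])
        also have "inf (x a - l) y = inf (x a) ?y - l"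
          using add_inf_distrib_right[of "x a" ?y "- l"] by simp
        also have "\<bar>\<dots>\<bar> \<le> d"
        proof (rule abs_leI)
          show "inf (x a) ?y - l \<le> d" using upper by (simp only: diff_le_eq add.commute)
          show "- (inf (x a) ?y - l) \<le> d"
            using lower by (simp only: minus_diff_eq diff_le_eq add.commute)
        qed
        finally show ?thesis .
      qed
      then show "c \<le> d" by (intro c eventually_mono[OF Q(1)])
    qed
  qed
  then show ?thesis ..
qed

lemma universally_complete_imp_uo_complete:
  assumes arch: "archimedean TYPE('a::vector_lattice)" and univ: "universally_complete TYPE('a)"
  shows "uo_complete TYPE('a)"
  unfolding uo_complete_def
proof (intro allI impI)
  fix A r and x :: "'a set \<times> 'a \<Rightarrow> 'a"
  assume dir: "directed_set A r" and "uo_Cauchy A r x"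
  let ?F = "net_filter A r"
  have F: "?F \<noteq> bot" "?F \<times>\<^sub>F ?F \<noteq> bot"
    using net_filter_neq_bot[OF dir] by (simp_all add: prod_filter_eq_bot)
  have Cauchy: "uo_null (?F \<times>\<^sub>F ?F) (\<lambda>(a, b). x a - x b)"
    using \<open>uo_Cauchy A r x\<close> unfolding uo_Cauchy_iff_uo_null[OF dir] .
  have "uo_null (?F \<times>\<^sub>F ?F) (\<lambda>(a, b). pprt (x a) - pprt (x b))"
    by (rule uo_null_mono[OF F(2) Cauchy]) (auto simp: abs_pprt_diff_le)
  then obtain l where l: "uo_null ?F (\<lambda>a. pprt (x a) - l)"
    using uo_limit_of_nonneg[OF arch univ F(1)] by force
  have "\<bar>pprt (- x a) - pprt (- x b)\<bar> \<le> \<bar>x a - x b\<bar>" for a b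
    using abs_pprt_diff_le[of "- x a" "- x b"] by (simp add: abs_minus_commute)
  then have "uo_null (?F \<times>\<^sub>F ?F) (\<lambda>(a, b). pprt (- x a) - pprt (- x b))"
    by (intro uo_null_mono[OF F(2) Cauchy]) auto
  then obtain m where m: "uo_null ?F (\<lambda>a. pprt (- x a) - m)"
    using uo_limit_of_nonneg[OF arch univ F(1)] by force
  have "pprt (x a) - l - (pprt (- x a) - m) = x a - (l - m)" for a
    using eq_pprt_diff_pprt[of "x a"] by (simp add: algebra_simps)
  then have "uo_null ?F (\<lambda>a. x a - (l - m))" using uo_null_diff[OF F(1) l m] by (simp only:)
  then show "\<exists>l. uo_converges A r x l" unfolding uo_converges_iff_uo_null[OF dir] ..
qed

theorem theorem15:
  assumes "archimedean TYPE('a::vector_lattice)"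
  shows "universally_complete TYPE('a) \<longleftrightarrow> uo_complete TYPE('a)"
  using universally_complete_imp_uo_complete[OF assms]
    uo_complete_imp_order_complete[OF assms] uo_complete_imp_laterally_complete[OF assms]
  unfolding universally_complete_def by blast

end
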